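(* Let $R$ be a ring, let $\mathfrak{F}_1\subseteq \mathfrak{F}_2$ be Gabriel filters of right ideals of $R$ with $\mathfrak{F}_1$ differential, and let $M$ be a right $R$-module. Suppose that either (i) $M_{\mathfrak{F}_1}$ is torsion-free with respect to the torsion theory corresponding to $\mathfrak{F}_2$, or (ii) $\mathfrak{F}_2$ is differential. Then for every derivation $\delta$ on $R$, any $\delta$-derivation $d$ on $M$ extends both to $M_{\mathfrak{F}_1}$ and to $M_{\mathfrak{F}_2}$ in such a way that the extensions on $M_{\mathfrak{F}_1}$ and $M_{\mathfrak{F}_2}$ agree.
   Context: Rings are associative with identity and modules are unital. Derivations. A derivation on $R$ is an additive map $\delta:R\to R$ with $\delta(rs)=\delta(r)s+r\delta(s)$. For a right $R$-module $M$, a $\delta$-derivation on $M$ is an additive map $d:M\to M$ with $d(xr)=d(x)r+x\delta(r)$ for all $x\in M$, $r\in R$. Modules of quotients. A Gabriel filter $\mathfrak{F}$ of right ideals corresponds to a hereditary torsion theory with torsion submodule $\mathcal{T}(M)=\{x\in M : \{r\in R: xr=0\}\in\mathfrak{F}\}$. The module of quotients is $M_{\mathfrak{F}}=\varinjlim_{I\in\mathfrak{F}}\mathrm{Hom}_R(I,M/\mathcal{T}(M))$, and $q_M:M\to M_{\mathfrak{F}}$ sends $m$ to the class of left multiplication by $m+\mathcal{T}(M)$. Differential filters. $\mathfrak{F}$ is differential if for every derivation $\delta$ on $R$ and every $I\in\mathfrak{F}$ there is $J\in\mathfrak{F}$ with $\delta(J)\subseteq I$. Extensions. A $\delta$-derivation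 $d$ on $M$ extends to $M_{\mathfrak{F}}$ if there is a $\delta$-derivation $d'$ on the right $R$-module $M_{\mathfrak{F}}$ with $d'q_M=q_Md$. Agreement. For $\mathfrak{F}_1\subseteq\mathfrak{F}_2$ with torsion submodules $\mathcal{T}_1(M)\subseteq\mathcal{T}_2(M)$ and maps $q_i:M\to M_{\mathfrak{F}_i}$, let $q_{12}:M_{\mathfrak{F}_1}\to M_{\mathfrak{F}_2}$ be the $R$-homomorphism sending the class of $f:I\to M/\mathcal{T}_1(M)$ ($I\in\mathfrak{F}_1$) to the class of the composite of $f$ with the projection $M/\mathcal{T}_1(M)\to M/\mathcal{T}_2(M)$; then $q_{12}q_1=q_2$. The extensions of $d$ on $M_{\mathfrak{F}_1}$ and $M_{\mathfrak{F}_2}$ agree if $d$ extends to $\delta$-derivations $d_i$ on $M_{\mathfrak{F}_i}$ with $d_1q_1=q_1d$, $d_2q_2=q_2d$ and $d_2q_{12}=q_{12}d_1$. *)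

theory Defs
  imports "HOL-Algebra.AbelCoset"
begin

text \<open>As for left modules in HOL-Algebra, the fields \<open>mult\<close> and \<open>one\<close> inherited from
  \<open>ring\<close> carry no meaning for a module.\<close>

record ('a, 'b) rmodule = "'b ring" +
  rsmult :: "'b \<Rightarrow> 'a \<Rightarrow> 'b" (infixl "\<cdot>\<index>" 70)

locale right_module = R?: ring R + M?: abelian_group M
  for R :: "('a, 'r) ring_scheme" (structure)
    and M :: "('a, 'b, 'm) rmodule_scheme" (structure) +
  assumes rsmult_closed:
      "\<lbrakk>x \<in> carrier M; r \<in> carrier R\<rbrakk> \<Longrightarrow> x \<cdot>\<^bsub>M\<^esub> r \<in> carrier M"
    and rsmult_l_distr:
      "\<lbrakk>x \<in> carrier M; y \<in> carrier M; r \<in> carrier R\<rbrakk> \<Longrightarrow>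
        (x \<oplus>\<^bsub>M\<^esub> y) \<cdot>\<^bsub>M\<^esub> r = x \<cdot>\<^bsub>M\<^esub> r \<oplus>\<^bsub>M\<^esub> y \<cdot>\<^bsub>M\<^esub> r"
    and rsmult_r_distr:
      "\<lbrakk>x \<in> carrier M; r \<in> carrier R; s \<in> carrier R\<rbrakk> \<Longrightarrow>
        x \<cdot>\<^bsub>M\<^esub> (r \<oplus>\<^bsub>R\<^esub> s) = x \<cdot>\<^bsub>M\<^esub> r \<oplus>\<^bsub>M\<^esub> x \<cdot>\<^bsub>M\<^esub> s"
    and rsmult_assoc:
      "\<lbrakk>x \<in> carrier M; r \<in> carrier R; s \<in> carrier R\<rbrakk> \<Longrightarrow>
        x \<cdot>\<^bsub>M\<^esub> (r \<otimes>\<^bsub>R\<^esub> s) = (x \<cdot>\<^bsub>M\<^esub> r) \<cdot>\<^bsub>M\<^esub> s"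
    and rsmult_one: "x \<in> carrier M \<Longrightarrow> x \<cdot>\<^bsub>M\<^esub> \<one>\<^bsub>R\<^esub> = x"

text \<open>Homomorphisms are extensional, so that equality of functions is equality of morphisms.\<close>

definition rmodule_hom ::
  "('a, 'r) ring_scheme \<Rightarrow> ('a, 'b, 'm) rmodule_scheme \<Rightarrow> ('a, 'c, 'n) rmodule_scheme \<Rightarrow> ('b \<Rightarrow> 'c) set"
  where "rmodule_hom R M N = {f \<in> carrier M \<rightarrow>\<^sub>E carrier N.
    (\<forall>x\<in>carrier M. \<forall>y\<in>carrier M. f (x \<oplus>\<^bsub>M\<^esub> y) = f x \<oplus>\<^bsub>N\<^esub> f y) \<and>
    (\<forall>x\<in>carrier M. \<forall>r\<in>carrier R. f (x \<cdot>\<^bsub>M\<^esub> r) = f x \<cdot>\<^bsub>N\<^esub> r)}"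

definition quotient_rmodule ::
  "('a, 'b, 'm) rmodule_scheme \<Rightarrow> 'b set \<Rightarrow> ('a, 'b set) rmodule"
  where "quotient_rmodule M N = \<lparr>
    carrier = a_rcosets\<^bsub>M\<^esub> N,
    mult = undefined, one = undefined,
    zero = N,
    add = set_add M,
    rsmult = (\<lambda>X r. \<Union>x\<in>X. N +>\<^bsub>M\<^esub> (x \<cdot>\<^bsub>M\<^esub> r))\<rparr>"

definition right_ideal :: "('a, 'r) ring_scheme \<Rightarrow> 'a set \<Rightarrow> bool"
  where "right_ideal R I \<longleftrightarrow> additive_subgroup I R \<and>
    (\<forall>x\<in>I. \<forall>r\<in>carrier R. x \<otimes>\<^bsub>R\<^esub> r \<in> I)"

definition right_ideal_module :: "('a, 'r) ring_scheme \<Rightarrow> 'a set \<Rightarrow> ('a, 'a) rmodule"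
  where "right_ideal_module R I = \<lparr>
    carrier = I,
    mult = undefined, one = undefined,
    zero = \<zero>\<^bsub>R\<^esub>,
    add = add R,
    rsmult = mult R\<rparr>"

definition ideal_residual :: "('a, 'r) ring_scheme \<Rightarrow> 'a set \<Rightarrow> 'a \<Rightarrow> 'a set"
  where "ideal_residual R I r = {s \<in> carrier R. r \<otimes>\<^bsub>R\<^esub> s \<in> I}"

locale gabriel_filter = ring R for R :: "('a, 'r) ring_scheme" (structure) +
  fixes F :: "'a set set"
  assumes right_ideals: "I \<in> F \<Longrightarrow> right_ideal R I"
    and nonempty: "F \<noteq> {}"
    and upward_closed: "\<lbrakk>I \<in> F; right_ideal R J; I \<subseteq> J\<rbrakk> \<Longrightarrow> J \<in> F"
    and inter_closed: "\<lbrakk>I \<in> F; J \<in> F\<rbrakk> \<Longrightarrow> I \<inter> J \<in> F"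
    and residual_closed: "\<lbrakk>I \<in> F; r \<in> carrier R\<rbrakk> \<Longrightarrow> ideal_residual R I r \<in> F"
    and locality: "\<lbrakk>right_ideal R I; J \<in> F; \<And>r. r \<in> J \<Longrightarrow> ideal_residual R I r \<in> F\<rbrakk> \<Longrightarrow> I \<in> F"

definition torsion ::
  "('a, 'r) ring_scheme \<Rightarrow> 'a set set \<Rightarrow> ('a, 'b, 'm) rmodule_scheme \<Rightarrow> 'b set"
  where "torsion R F M = {x \<in> carrier M. {r \<in> carrier R. x \<cdot>\<^bsub>M\<^esub> r = \<zero>\<^bsub>M\<^esub>} \<in> F}"

definition torsion_free ::
  "('a, 'r) ring_scheme \<Rightarrow> 'a set set \<Rightarrow> ('a, 'b, 'm) rmodule_scheme \<Rightarrow> bool"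
  where "torsion_free R F M \<longleftrightarrow> torsion R F M = {\<zero>\<^bsub>M\<^esub>}"

abbreviation torsion_quotient ::
  "('a, 'r) ring_scheme \<Rightarrow> 'a set set \<Rightarrow> ('a, 'b, 'm) rmodule_scheme \<Rightarrow> ('a, 'b set) rmodule"
  where "torsion_quotient R F M \<equiv> quotient_rmodule M (torsion R F M)"

text \<open>The direct limit of the groups \<open>Hom(I, M/T(M))\<close>, for \<open>I\<close> in \<open>F\<close> ordered by reverse
  inclusion, consists of the pairs \<open>(I, f)\<close> modulo agreement on some smaller member of \<open>F\<close>.\<close>

definition partial_homs ::
  "('a, 'r) ring_scheme \<Rightarrow> 'a set set \<Rightarrow> ('a, 'b, 'm) rmodule_scheme \<Rightarrow> ('a set \<times> ('a \<Rightarrow> 'b set)) set"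
  where "partial_homs R F M =
    (SIGMA I:F. rmodule_hom R (right_ideal_module R I) (torsion_quotient R F M))"

definition partial_homs_rel ::
  "('a, 'r) ring_scheme \<Rightarrow> 'a set set \<Rightarrow> ('a, 'b, 'm) rmodule_scheme \<Rightarrow>
    ((('a set \<times> ('a \<Rightarrow> 'b set)) \<times> ('a set \<times> ('a \<Rightarrow> 'b set))) set)"
  where "partial_homs_rel R F M = {((I, f), (J, g)).
    (I, f) \<in> partial_homs R F M \<and> (J, g) \<in> partial_homs R F M \<and>
    (\<exists>K\<in>F. K \<subseteq> I \<inter> J \<and> restrict f K = restrict g K)}"

definition hom_class ::
  "('a, 'r) ring_scheme \<Rightarrow> 'a set set \<Rightarrow> ('a, 'b, 'm) rmodule_scheme \<Rightarrow>
    'a set \<Rightarrow> ('a \<Rightarrow> 'b set) \<Rightarrow> ('a set \<times> ('a \<Rightarrow> 'b set)) set"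
  where "hom_class R F M I f = partial_homs_rel R F M `` {(I, f)}"

text \<open>The scalar action is induced by \<open>(f \<cdot> r)(s) = f (r s)\<close>.\<close>

definition module_of_quotients ::
  "('a, 'r) ring_scheme \<Rightarrow> 'a set set \<Rightarrow> ('a, 'b, 'm) rmodule_scheme \<Rightarrow>
    ('a, ('a set \<times> ('a \<Rightarrow> 'b set)) set) rmodule"
  where "module_of_quotients R F M = \<lparr>
    carrier = partial_homs R F M // partial_homs_rel R F M,
    mult = undefined, one = undefined,
    zero = hom_class R F M (carrier R) (\<lambda>r\<in>carrier R. \<zero>\<^bsub>torsion_quotient R F M\<^esub>),
    add = (\<lambda>X Y. \<Union>(I, f)\<in>X. \<Union>(J, g)\<in>Y.
      hom_class R F M (I \<inter> J) (\<lambda>s\<in>I \<inter> J. f s \<oplus>\<^bsub>torsion_quotient R F M\<^esub> g s)),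
    rsmult = (\<lambda>X r. \<Union>(I, f)\<in>X.
      hom_class R F M (ideal_residual R I r) (\<lambda>s\<in>ideal_residual R I r. f (r \<otimes>\<^bsub>R\<^esub> s)))\<rparr>"

definition quotient_map ::
  "('a, 'r) ring_scheme \<Rightarrow> 'a set set \<Rightarrow> ('a, 'b, 'm) rmodule_scheme \<Rightarrow>
    'b \<Rightarrow> ('a set \<times> ('a \<Rightarrow> 'b set)) set"
  where "quotient_map R F M m = hom_class R F M (carrier R)
    (\<lambda>r\<in>carrier R. (torsion R F M +>\<^bsub>M\<^esub> m) \<cdot>\<^bsub>torsion_quotient R F M\<^esub> r)"

text \<open>In the next two definitions \<open>F\<^sub>1 \<subseteq> F\<^sub>2\<close> is intended. The first is the projection
  \<open>M/T\<^sub>1(M) \<rightarrow> M/T\<^sub>2(M)\<close>.\<close>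

definition torsion_quotient_proj ::
  "('a, 'r) ring_scheme \<Rightarrow> 'a set set \<Rightarrow> ('a, 'b, 'm) rmodule_scheme \<Rightarrow> 'b set \<Rightarrow> 'b set"
  where "torsion_quotient_proj R F\<^sub>2 M X = (\<Union>x\<in>X. torsion R F\<^sub>2 M +>\<^bsub>M\<^esub> x)"

definition quotient_change ::
  "('a, 'r) ring_scheme \<Rightarrow> 'a set set \<Rightarrow> ('a, 'b, 'm) rmodule_scheme \<Rightarrow>
    ('a set \<times> ('a \<Rightarrow> 'b set)) set \<Rightarrow> ('a set \<times> ('a \<Rightarrow> 'b set)) set"
  where "quotient_change R F\<^sub>2 M X = (\<Union>(I, f)\<in>X.
    hom_class R F\<^sub>2 M I (\<lambda>s\<in>I. torsion_quotient_proj R F\<^sub>2 M (f s)))"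

definition derivation :: "('a, 'r) ring_scheme \<Rightarrow> ('a \<Rightarrow> 'a) \<Rightarrow> bool"
  where "derivation R \<delta> \<longleftrightarrow> \<delta> \<in> carrier R \<rightarrow> carrier R \<and>
    (\<forall>r\<in>carrier R. \<forall>s\<in>carrier R. \<delta> (r \<oplus>\<^bsub>R\<^esub> s) = \<delta> r \<oplus>\<^bsub>R\<^esub> \<delta> s) \<and>
    (\<forall>r\<in>carrier R. \<forall>s\<in>carrier R. \<delta> (r \<otimes>\<^bsub>R\<^esub> s) = \<delta> r \<otimes>\<^bsub>R\<^esub> s \<oplus>\<^bsub>R\<^esub> r \<otimes>\<^bsub>R\<^esub> \<delta> s)"

definition module_derivation ::
  "('a, 'r) ring_scheme \<Rightarrow> ('a \<Rightarrow> 'a) \<Rightarrow> ('a, 'b, 'm) rmodule_scheme \<Rightarrow> ('b \<Rightarrow> 'b) \<Rightarrow> bool"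
  where "module_derivation R \<delta> M d \<longleftrightarrow> d \<in> carrier M \<rightarrow> carrier M \<and>
    (\<forall>x\<in>carrier M. \<forall>y\<in>carrier M. d (x \<oplus>\<^bsub>M\<^esub> y) = d x \<oplus>\<^bsub>M\<^esub> d y) \<and>
    (\<forall>x\<in>carrier M. \<forall>r\<in>carrier R. d (x \<cdot>\<^bsub>M\<^esub> r) = d x \<cdot>\<^bsub>M\<^esub> r \<oplus>\<^bsub>M\<^esub> x \<cdot>\<^bsub>M\<^esub> \<delta> r)"

definition differential_filter :: "('a, 'r) ring_scheme \<Rightarrow> 'a set set \<Rightarrow> bool"
  where "differential_filter R F \<longleftrightarrow>
    (\<forall>\<delta>. derivation R \<delta> \<longrightarrow> (\<forall>I\<in>F. \<exists>J\<in>F. \<delta> ` J \<subseteq> I))"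

definition extends_derivation ::
  "('a, 'r) ring_scheme \<Rightarrow> 'a set set \<Rightarrow> ('a, 'b, 'm) rmodule_scheme \<Rightarrow> ('a \<Rightarrow> 'a) \<Rightarrow> ('b \<Rightarrow> 'b) \<Rightarrow>
    (('a set \<times> ('a \<Rightarrow> 'b set)) set \<Rightarrow> ('a set \<times> ('a \<Rightarrow> 'b set)) set) \<Rightarrow> bool"
  where "extends_derivation R F M \<delta> d d' \<longleftrightarrow>
    module_derivation R \<delta> (module_of_quotients R F M) d' \<and>
    (\<forall>x\<in>carrier M. d' (quotient_map R F M x) = quotient_map R F M (d x))"

end

(* Every Gabriel filter is differential. Hence d preserves the torsion submodule T of M and induces
   a derivation on M/T, and sending the class of f to the class of s |-> d (f s) - f (delta s),
   for s in the domain I of f with delta s in I, extends d to the module of quotients. The formula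
   is natural in the filter, so the extensions for two comparable filters agree. *)
theory Submission
  imports Defs
begin

text \<open>The formula is forced: if \<open>f\<close> is read as left multiplication by an element
  \<xi> of the module of quotients, the Leibniz rule d'(\<xi> s) = d'(\<xi>) s + \<xi> \<delta>(s)
  can only be solved as d'(\<xi>) s = d(f s) - f(\<delta> s). Neither term is
  \<open>R\<close>-linear in \<open>s\<close>; replacing \<open>s\<close> by \<open>s r\<close>
  produces the same defect f(s) \<delta>(r) in both, and it cancels in the difference. Everything
  therefore rests on one set, the elements \<open>s\<close> of \<open>I\<close> with \<delta>
  \<open>s\<close> in \<open>I\<close>, being a member of the filter, and this is where locality
  enters. The set is built from \<open>I\<close> and \<delta> alone, so two filters containing
  \<open>I\<close> use the same domain and agreement becomes a pointwise identity. The remaining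
  work is independence of representatives: cosets, scalar action, sums in the direct limit and the
  maps between limits are all unions over representatives, and each union must be collapsed to a
  single value before anything can be computed.\<close>

lemma (in abelian_group) diff_add_distrib:
  assumes "a \<in> carrier G" "b \<in> carrier G" "c \<in> carrier G" "e \<in> carrier G"
  shows "(a \<oplus> b) \<ominus> (c \<oplus> e) = (a \<ominus> c) \<oplus> (b \<ominus> e)"
  using assms by (simp add: minus_eq minus_add a_ac)

lemma (in abelian_group) diff_add_cancel_right:
  assumes "a \<in> carrier G" "b \<in> carrier G" "c \<in> carrier G"
  shows "(a \<oplus> b) \<ominus> (c \<oplus> b) = a \<ominus> c"
  using diff_add_distrib[of a b c b] assms by (simp add: minus_eq r_neg)

lemma (in abelian_group) rcoset_absorb:
  assumes "abelian_subgroup N G" "n \<in> N" "x \<in> carrier G"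
  shows "N +> (n \<oplus> x) = N +> x"
proof -
  interpret abelian_subgroup N G by fact
  show ?thesis
    using a_coset_add_assoc[OF a_subset, of n x] a_rcos_const[of n] assms by simp
qed

text \<open>Changing \<open>y\<close> within its coset of \<open>N\<close> changes
  \<open>h y\<close> by an element of \<open>N'\<close>, so the union runs over equal cosets, and it
  is nonempty because \<open>x\<close> itself occurs. Three choices of \<open>h\<close> are used:
  multiplication by a scalar, the derivation \<open>d\<close>, and the identity with
  \<open>N\<close> and \<open>N'\<close> the torsion submodules of two filters.\<close>

lemma (in abelian_group) UN_rcoset_eq:
  assumes N: "abelian_subgroup N G" "abelian_subgroup N' G"
    and h: "h \<in> carrier G \<rightarrow> carrier G"
      "\<And>x y. \<lbrakk>x \<in> carrier G; y \<in> carrier G\<rbrakk> \<Longrightarrow> h (x \<oplus> y) = h x \<oplus> h y"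
    and hN: "\<And>n. n \<in> N \<Longrightarrow> h n \<in> N'"
    and x: "x \<in> carrier G"
  shows "(\<Union>y\<in>N +> x. N' +> h y) = N' +> h x"
proof -
  interpret N: abelian_subgroup N G by fact
  have "N' +> h y = N' +> h x" if y: "y \<in> N +> x" for y
  proof -
    obtain n where n: "n \<in> N" "y = n \<oplus> x"
      using y by (auto simp: a_r_coset_def')
    then show ?thesis
      using h x hN rcoset_absorb[OF N(2), of "h n" "h x"] N.a_Hcarr by (auto simp: Pi_iff)
  qed
  moreover have "x \<in> N +> x" using N.a_rcos_self x by blast
  ultimately show ?thesis by blast
qed

section \<open>Right modules, submodules and quotient modules\<close>

context right_module
begin

lemma rsmult_zero_right:
  assumes "x \<in> carrier M" shows "x \<cdot>\<^bsub>M\<^esub> \<zero>\<^bsub>R\<^esub> = \<zero>\<^bsub>M\<^esub>"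
  using rsmult_r_distr[OF assms R.zero_closed R.zero_closed] rsmult_closed[OF assms R.zero_closed]
  by simp

lemma rsmult_zero_left:
  assumes "r \<in> carrier R" shows "\<zero>\<^bsub>M\<^esub> \<cdot>\<^bsub>M\<^esub> r = \<zero>\<^bsub>M\<^esub>"
  using rsmult_l_distr[OF M.zero_closed M.zero_closed assms] rsmult_closed[OF M.zero_closed assms]
  by simp

lemma rsmult_minus_left:
  assumes "x \<in> carrier M" "r \<in> carrier R"
  shows "(\<ominus>\<^bsub>M\<^esub> x) \<cdot>\<^bsub>M\<^esub> r = \<ominus>\<^bsub>M\<^esub> (x \<cdot>\<^bsub>M\<^esub> r)"
  using rsmult_l_distr[of "\<ominus>\<^bsub>M\<^esub> x" x r] assms
  by (simp add: M.l_neg rsmult_zero_left rsmult_closed M.minus_equality)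

text \<open>This reduces negation to the scalar action: closure under scalars gives closure under
  negatives, and a map respecting sums and scalars respects differences.\<close>

lemma rsmult_minus_one:
  assumes "x \<in> carrier M"
  shows "x \<cdot>\<^bsub>M\<^esub> (\<ominus>\<^bsub>R\<^esub> \<one>\<^bsub>R\<^esub>) = \<ominus>\<^bsub>M\<^esub> x"
  using rsmult_r_distr[of x "\<ominus>\<^bsub>R\<^esub> \<one>\<^bsub>R\<^esub>" "\<one>\<^bsub>R\<^esub>"] assms
  by (simp add: R.l_neg rsmult_zero_right rsmult_closed rsmult_one M.minus_equality)

lemma rsmult_diff_left:
  assumes "x \<in> carrier M" "y \<in> carrier M" "r \<in> carrier R"
  shows "(x \<ominus>\<^bsub>M\<^esub> y) \<cdot>\<^bsub>M\<^esub> r = x \<cdot>\<^bsub>M\<^esub> r \<ominus>\<^bsub>M\<^esub> y \<cdot>\<^bsub>M\<^esub> r"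
  using assms by (simp add: M.minus_eq rsmult_l_distr rsmult_minus_left)

lemma submodule_abelian_subgroupI:
  assumes "N \<subseteq> carrier M" "\<zero>\<^bsub>M\<^esub> \<in> N"
    and "\<And>x y. \<lbrakk>x \<in> N; y \<in> N\<rbrakk> \<Longrightarrow> x \<oplus>\<^bsub>M\<^esub> y \<in> N"
    and "\<And>x r. \<lbrakk>x \<in> N; r \<in> carrier R\<rbrakk> \<Longrightarrow> x \<cdot>\<^bsub>M\<^esub> r \<in> N"
  shows "abelian_subgroup N M"
proof (rule abelian_subgroupI3)
  show "additive_subgroup N M"
  proof (rule additive_subgroup.intro, rule group.subgroupI[OF M.a_group])
    fix x assume "x \<in> N"
    then show "inv\<^bsub>add_monoid M\<^esub> x \<in> N"
      using assms(1) assms(4)[of x "\<ominus>\<^bsub>R\<^esub> \<one>\<^bsub>R\<^esub>"] rsmult_minus_one[of x]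
      by (auto simp: a_inv_def)
  qed (use assms in auto)
qed (rule M.abelian_group_axioms)

text \<open>Closure of \<open>N\<close> under scalars is what makes the union defining the scalar
  action a single coset. Once carrier, zero, sum and action are expressed through representatives,
  each module axiom is inherited from \<open>M\<close>.\<close>

lemma
  assumes N: "abelian_subgroup N M"
    and smult: "\<And>x r. \<lbrakk>x \<in> N; r \<in> carrier R\<rbrakk> \<Longrightarrow> x \<cdot>\<^bsub>M\<^esub> r \<in> N"
  shows rsmult_quotient_rmodule:
      "\<And>x r. \<lbrakk>x \<in> carrier M; r \<in> carrier R\<rbrakk> \<Longrightarrow>
        (N +>\<^bsub>M\<^esub> x) \<cdot>\<^bsub>quotient_rmodule M N\<^esub> r = N +>\<^bsub>M\<^esub> (x \<cdot>\<^bsub>M\<^esub> r)"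
    and quotient_rmodule_right_module: "right_module R (quotient_rmodule M N)"
proof -
  let ?Q = "quotient_rmodule M N"
  interpret N: abelian_subgroup N M by fact
  have car: "X \<in> carrier ?Q \<longleftrightarrow> (\<exists>x\<in>carrier M. X = N +>\<^bsub>M\<^esub> x)" for X
    by (auto simp: quotient_rmodule_def A_RCOSETS_def')
  have add: "(N +>\<^bsub>M\<^esub> x) \<oplus>\<^bsub>?Q\<^esub> (N +>\<^bsub>M\<^esub> y) = N +>\<^bsub>M\<^esub> (x \<oplus>\<^bsub>M\<^esub> y)"
    if "x \<in> carrier M" "y \<in> carrier M" for x y
    using N.a_rcos_sum that by (simp add: quotient_rmodule_def)
  have zero: "\<zero>\<^bsub>?Q\<^esub> = N +>\<^bsub>M\<^esub> \<zero>\<^bsub>M\<^esub>"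
    by (simp add: quotient_rmodule_def N.a_subset)
  show sm: "(N +>\<^bsub>M\<^esub> x) \<cdot>\<^bsub>?Q\<^esub> r = N +>\<^bsub>M\<^esub> (x \<cdot>\<^bsub>M\<^esub> r)"
    if "x \<in> carrier M" "r \<in> carrier R" for x r
    using M.UN_rcoset_eq[OF N N, of "\<lambda>x. x \<cdot>\<^bsub>M\<^esub> r" x] that smult
    by (simp add: quotient_rmodule_def rsmult_closed rsmult_l_distr)
  have "abelian_group ?Q"
  proof (rule abelian_groupI)
    fix X assume "X \<in> carrier ?Q"
    then obtain x where "x \<in> carrier M" "X = N +>\<^bsub>M\<^esub> x" by (auto simp: car)
    then show "\<exists>Y\<in>carrier ?Q. Y \<oplus>\<^bsub>?Q\<^esub> X = \<zero>\<^bsub>?Q\<^esub>"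
      by (intro bexI[of _ "N +>\<^bsub>M\<^esub> (\<ominus>\<^bsub>M\<^esub> x)"]) (auto simp: add zero car M.l_neg)
  qed (auto simp: car zero add M.a_ac intro: bexI[OF _ M.add.m_closed])
  then show "right_module R ?Q"
    by (intro right_module.intro right_module_axioms.intro R.ring_axioms)
      (auto simp: car zero add sm rsmult_closed rsmult_l_distr rsmult_r_distr rsmult_assoc rsmult_one)
qed

end

section \<open>Right ideals, and the filter members cut out by a derivation\<close>

lemma (in ring) right_idealI:
  assumes "I \<subseteq> carrier R" "\<zero> \<in> I"
    and "\<And>x y. \<lbrakk>x \<in> I; y \<in> I\<rbrakk> \<Longrightarrow> x \<oplus> y \<in> I"
    and "\<And>x r. \<lbrakk>x \<in> I; r \<in> carrier R\<rbrakk> \<Longrightarrow> x \<otimes> r \<in> I"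
  shows "right_ideal R I"
  unfolding right_ideal_def
proof
  show "additive_subgroup I R"
  proof (rule additive_subgroup.intro, rule group.subgroupI[OF a_group])
    fix x assume "x \<in> I"
    then show "inv\<^bsub>add_monoid R\<^esub> x \<in> I"
      \<comment> \<open>Right multiplication by \<open>\<ominus> \<one>\<close> supplies the
        additive inverse.\<close>
      using assms(1) assms(4)[of x "\<ominus> \<one>"] by (auto simp: a_inv_def[symmetric] r_minus)
  qed (use assms in auto)
qed (use assms in auto)

lemma (in ring)
  assumes "right_ideal R I"
  shows right_ideal_subset: "I \<subseteq> carrier R"
    and right_ideal_zero: "\<zero> \<in> I"
    and right_ideal_add: "\<And>x y. \<lbrakk>x \<in> I; y \<in> I\<rbrakk> \<Longrightarrow> x \<oplus> y \<in> I"
    and right_ideal_mult: "\<And>x r. \<lbrakk>x \<in> I; r \<in> carrier R\<rbrakk> \<Longrightarrow> x \<otimes> r \<in> I"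
  using assms unfolding right_ideal_def
  by (auto dest: additive_subgroup.a_subset additive_subgroup.zero_closed additive_subgroup.a_closed)

lemma (in ring) derivation_zero:
  assumes "derivation R \<delta>"
  shows "\<delta> \<zero> = \<zero>"
proof -
  have "\<delta> \<zero> \<in> carrier R" "\<delta> (\<zero> \<oplus> \<zero>) = \<delta> \<zero> \<oplus> \<delta> \<zero>"
    using assms unfolding derivation_def by blast+
  then show ?thesis by simp
qed

text \<open>Both \<open>f s\<close> and \<open>f (\<delta> s)\<close> must make sense for
  \<open>f\<close> defined on \<open>I\<close>, hence the two conditions. No filter occurs in the
  definition, so two filters can share the set.\<close>

definition derivation_preimage :: "('a \<Rightarrow> 'a) \<Rightarrow> 'a set \<Rightarrow> 'a set"
  where "derivation_preimage \<delta> I = {s \<in> I. \<delta> s \<in> I}"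

context gabriel_filter
begin

lemma carrier_in_filter: "carrier R \<in> F"
proof -
  obtain I where I: "I \<in> F" using nonempty by blast
  have "right_ideal R (carrier R)" by (rule right_idealI) auto
  then show ?thesis
    using upward_closed[OF I] right_ideal_subset[OF right_ideals[OF I]] by blast
qed

lemma filter_subset: "I \<in> F \<Longrightarrow> I \<subseteq> carrier R"
  using right_ideals right_ideal_subset by blast

text \<open>Modulo \<open>I\<close> the map \<open>\<delta>\<close> is right \<open>R\<close>-linear on \<open>I\<close>, so for \<open>J\<close> the preimage below
  \<open>I/J\<close> embeds into the torsion module \<open>R/I\<close>; hence locality applies.\<close>

lemma derivation_preimage_in_filter:
  assumes \<delta>: "derivation R \<delta>" and I: "I \<in> F"
  shows "derivation_preimage \<delta> I \<in> F"
proof (rule locality[OF _ I])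
  note id = right_ideal_subset[OF right_ideals[OF I]] right_ideal_zero[OF right_ideals[OF I]]
    right_ideal_add[OF right_ideals[OF I]] right_ideal_mult[OF right_ideals[OF I]]
  have \<delta>c: "\<And>r. r \<in> carrier R \<Longrightarrow> \<delta> r \<in> carrier R"
    and \<delta>a: "\<And>r s. \<lbrakk>r \<in> carrier R; s \<in> carrier R\<rbrakk> \<Longrightarrow> \<delta> (r \<oplus> s) = \<delta> r \<oplus> \<delta> s"
    and \<delta>m: "\<And>r s. \<lbrakk>r \<in> carrier R; s \<in> carrier R\<rbrakk> \<Longrightarrow> \<delta> (r \<otimes> s) = \<delta> r \<otimes> s \<oplus> r \<otimes> \<delta> s"
    using \<delta> unfolding derivation_def by auto
  \<comment> \<open>For closure under multiplication, \<delta>(s r) = \<delta>(s) r + s \<delta>(r):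
    the first term is in \<open>I\<close> because \<delta>(s) is, the second because
    \<open>s\<close> is.\<close>
  show rJ: "right_ideal R (derivation_preimage \<delta> I)"
    using id
    by (intro right_idealI)
      (auto simp: derivation_preimage_def derivation_zero[OF \<delta>] \<delta>a \<delta>m \<delta>c subset_iff)
  fix s assume s: "s \<in> I"
  then have sc: "s \<in> carrier R" using id by blast
  show "ideal_residual R (derivation_preimage \<delta> I) s \<in> F"
  proof (rule upward_closed[OF residual_closed[OF I \<delta>c[OF sc]]])
    show "right_ideal R (ideal_residual R (derivation_preimage \<delta> I) s)"
      using sc right_ideal_zero[OF rJ] right_ideal_add[OF rJ] right_ideal_mult[OF rJ]
      by (intro right_idealI) (auto simp: ideal_residual_def r_distr m_assoc[symmetric])
    \<comment> \<open>Let \<delta>(s) t be in \<open>I\<close>. Since \<open>s\<close> is in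
      \<open>I\<close>, so are \<open>s t\<close> and s \<delta>(t), and then \<delta>(s t) =
      \<delta>(s) t + s \<delta>(t) is in \<open>I\<close> as well.\<close>
    show "ideal_residual R I (\<delta> s) \<subseteq> ideal_residual R (derivation_preimage \<delta> I) s"
      using sc s id by (auto simp: ideal_residual_def derivation_preimage_def \<delta>m \<delta>c)
  qed
qed

end

section \<open>The torsion submodule and the torsion quotient for one filter\<close>

locale gabriel_module = right_module R M + gabriel_filter R F
  for R :: "('a, 'r) ring_scheme" (structure) and F
    and M :: "('a, 'b, 'm) rmodule_scheme" (structure)
begin

abbreviation "T \<equiv> torsion R F M"
abbreviation "Q \<equiv> torsion_quotient R F M"

lemma annihilator_right_ideal:
  assumes "x \<in> carrier M"
  shows "right_ideal R {r \<in> carrier R. x \<cdot>\<^bsub>M\<^esub> r = \<zero>\<^bsub>M\<^esub>}"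
  using assms
  by (intro R.right_idealI)
    (auto simp: rsmult_zero_right rsmult_zero_left rsmult_r_distr rsmult_assoc)

text \<open>The annihilator of \<open>x\<close> is a right ideal, so by upward closure it belongs to
  \<open>F\<close> as soon as it contains a member of \<open>F\<close>. Torsion can then be proved
  by exhibiting any member that kills \<open>x\<close>.\<close>

lemma torsion_iff:
  "x \<in> T \<longleftrightarrow> x \<in> carrier M \<and> (\<exists>I\<in>F. \<forall>r\<in>I. x \<cdot>\<^bsub>M\<^esub> r = \<zero>\<^bsub>M\<^esub>)"
proof
  assume r: "x \<in> carrier M \<and> (\<exists>I\<in>F. \<forall>r\<in>I. x \<cdot>\<^bsub>M\<^esub> r = \<zero>\<^bsub>M\<^esub>)"
  then obtain I where I: "I \<in> F" "\<forall>r\<in>I. x \<cdot>\<^bsub>M\<^esub> r = \<zero>\<^bsub>M\<^esub>" by blast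
  then show "x \<in> T"
    using r upward_closed[OF I(1) annihilator_right_ideal[of x]] filter_subset[OF I(1)]
    by (auto simp: torsion_def)
next
  assume "x \<in> T"
  then show "x \<in> carrier M \<and> (\<exists>I\<in>F. \<forall>r\<in>I. x \<cdot>\<^bsub>M\<^esub> r = \<zero>\<^bsub>M\<^esub>)"
    by (intro conjI bexI[of _ "{r \<in> carrier R. x \<cdot>\<^bsub>M\<^esub> r = \<zero>\<^bsub>M\<^esub>}"]) (simp_all add: torsion_def)
qed

text \<open>If \<open>I\<close> kills \<open>x\<close>, then the residual of \<open>I\<close> by
  \<open>r\<close> kills \<open>x r\<close>, since (x r) s = x (r s).\<close>

lemma torsion_rsmult:
  assumes "x \<in> T" "r \<in> carrier R" shows "x \<cdot>\<^bsub>M\<^esub> r \<in> T"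
proof -
  obtain I where I: "I \<in> F" "\<And>r. r \<in> I \<Longrightarrow> x \<cdot>\<^bsub>M\<^esub> r = \<zero>\<^bsub>M\<^esub>" and x: "x \<in> carrier M"
    using assms(1) unfolding torsion_iff by blast
  have "(x \<cdot>\<^bsub>M\<^esub> r) \<cdot>\<^bsub>M\<^esub> s = \<zero>\<^bsub>M\<^esub>" if "s \<in> ideal_residual R I r" for s
    using that I(2) assms(2) x by (auto simp: ideal_residual_def rsmult_assoc[symmetric])
  then show ?thesis
    unfolding torsion_iff using residual_closed[OF I(1) assms(2)] x assms(2) rsmult_closed by blast
qed

lemma torsion_abelian_subgroup: "abelian_subgroup T M"
proof (rule submodule_abelian_subgroupI)
  show "T \<subseteq> carrier M" by (auto simp: torsion_iff)
  show "\<zero>\<^bsub>M\<^esub> \<in> T"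
    unfolding torsion_iff using carrier_in_filter rsmult_zero_left by blast
  fix x y assume "x \<in> T" "y \<in> T"
  then obtain I J where "I \<in> F" "\<forall>r\<in>I. x \<cdot>\<^bsub>M\<^esub> r = \<zero>\<^bsub>M\<^esub>" "J \<in> F" "\<forall>r\<in>J. y \<cdot>\<^bsub>M\<^esub> r = \<zero>\<^bsub>M\<^esub>"
    and "x \<in> carrier M" "y \<in> carrier M" unfolding torsion_iff by blast
  then show "x \<oplus>\<^bsub>M\<^esub> y \<in> T"
    unfolding torsion_iff using filter_subset[of I]
    by (auto intro!: bexI[OF _ inter_closed[of I J]] simp: rsmult_l_distr subset_iff)
qed (rule torsion_rsmult)

sublocale T: abelian_subgroup T M
  by (rule torsion_abelian_subgroup)

sublocale Q: right_module R Q
  by (rule quotient_rmodule_right_module[OF torsion_abelian_subgroup torsion_rsmult])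

lemma carrier_quotient: "X \<in> carrier Q \<longleftrightarrow> (\<exists>x\<in>carrier M. X = T +>\<^bsub>M\<^esub> x)"
  by (auto simp: quotient_rmodule_def A_RCOSETS_def')

lemma coset_in_quotient: "x \<in> carrier M \<Longrightarrow> T +>\<^bsub>M\<^esub> x \<in> carrier Q"
  by (auto simp: carrier_quotient)

lemma add_coset:
  "\<lbrakk>x \<in> carrier M; y \<in> carrier M\<rbrakk> \<Longrightarrow>
    (T +>\<^bsub>M\<^esub> x) \<oplus>\<^bsub>Q\<^esub> (T +>\<^bsub>M\<^esub> y) = T +>\<^bsub>M\<^esub> (x \<oplus>\<^bsub>M\<^esub> y)"
  using T.a_rcos_sum by (simp add: quotient_rmodule_def)

lemmas rsmult_coset = rsmult_quotient_rmodule[OF torsion_abelian_subgroup torsion_rsmult]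

section \<open>Partial homomorphisms and the operations on their direct limit\<close>

lemma partial_homs_iff:
  "(I, f) \<in> partial_homs R F M \<longleftrightarrow> I \<in> F \<and> f \<in> I \<rightarrow>\<^sub>E carrier Q \<and>
    (\<forall>s\<in>I. \<forall>t\<in>I. f (s \<oplus>\<^bsub>R\<^esub> t) = f s \<oplus>\<^bsub>Q\<^esub> f t) \<and>
    (\<forall>s\<in>I. \<forall>r\<in>carrier R. f (s \<otimes>\<^bsub>R\<^esub> r) = f s \<cdot>\<^bsub>Q\<^esub> r)"
  by (auto simp: partial_homs_def rmodule_hom_def right_ideal_module_def)

lemma partial_homsD:
  assumes "(I, f) \<in> partial_homs R F M"
  shows "I \<in> F" "s \<in> I \<Longrightarrow> f s \<in> carrier Q"
    "\<lbrakk>s \<in> I; t \<in> I\<rbrakk> \<Longrightarrow> f (s \<oplus>\<^bsub>R\<^esub> t) = f s \<oplus>\<^bsub>Q\<^esub> f t"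
    "\<lbrakk>s \<in> I; r \<in> carrier R\<rbrakk> \<Longrightarrow> f (s \<otimes>\<^bsub>R\<^esub> r) = f s \<cdot>\<^bsub>Q\<^esub> r"
  using assms by (auto simp: partial_homs_iff PiE_iff)

lemma partial_homs_restrictI:
  assumes I: "I \<in> F"
    and "\<And>s. s \<in> I \<Longrightarrow> f s \<in> carrier Q"
    and "\<And>s t. \<lbrakk>s \<in> I; t \<in> I\<rbrakk> \<Longrightarrow> f (s \<oplus>\<^bsub>R\<^esub> t) = f s \<oplus>\<^bsub>Q\<^esub> f t"
    and "\<And>s r. \<lbrakk>s \<in> I; r \<in> carrier R\<rbrakk> \<Longrightarrow> f (s \<otimes>\<^bsub>R\<^esub> r) = f s \<cdot>\<^bsub>Q\<^esub> r"
  shows "(I, restrict f I) \<in> partial_homs R F M"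
  using assms R.right_ideal_add[OF right_ideals[OF I]] R.right_ideal_mult[OF right_ideals[OF I]]
  by (auto simp: partial_homs_iff)

lemma partial_homs_rel_iff:
  "((I, f), (J, g)) \<in> partial_homs_rel R F M \<longleftrightarrow>
    (I, f) \<in> partial_homs R F M \<and> (J, g) \<in> partial_homs R F M \<and>
    (\<exists>K\<in>F. K \<subseteq> I \<and> K \<subseteq> J \<and> (\<forall>s\<in>K. f s = g s))"
proof -
  have "restrict f K = restrict g K \<longleftrightarrow> (\<forall>s\<in>K. f s = g s)" for K
    by (metis restrict_apply' restrict_ext)
  then show ?thesis by (simp add: partial_homs_rel_def)
qed

lemma equiv_partial_homs_rel: "equiv (partial_homs R F M) (partial_homs_rel R F M)"
proof (rule equivI)
  show "refl_on (partial_homs R F M) (partial_homs_rel R F M)"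
    using partial_homsD(1) by (fastforce simp: refl_on_def partial_homs_rel_iff)
  show "sym (partial_homs_rel R F M)"
  proof (rule symI, clarify)
    fix I f J g assume "((I, f), (J, g)) \<in> partial_homs_rel R F M"
    then show "((J, g), (I, f)) \<in> partial_homs_rel R F M"
      unfolding partial_homs_rel_iff by metis
  qed
  show "trans (partial_homs_rel R F M)"
  proof (rule transI, clarify)
    fix I f J g K h
    assume "((I, f), (J, g)) \<in> partial_homs_rel R F M" "((J, g), (K, h)) \<in> partial_homs_rel R F M"
    then obtain A B where "A \<in> F" "A \<subseteq> I" "\<forall>s\<in>A. f s = g s" "B \<in> F" "B \<subseteq> K" "\<forall>s\<in>B. g s = h s"
      and "(I, f) \<in> partial_homs R F M" "(K, h) \<in> partial_homs R F M"
      unfolding partial_homs_rel_iff by blast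
    then show "((I, f), (K, h)) \<in> partial_homs_rel R F M"
      unfolding partial_homs_rel_iff using inter_closed[of A B]
      by (auto intro!: bexI[of _ "A \<inter> B"])
  qed
qed (auto simp: partial_homs_rel_def)

text \<open>Every identity in the module of quotients is proved through this rule: choose a member
  \<open>K\<close> inside both domains and compare the representatives pointwise on
  \<open>K\<close>.\<close>

lemma hom_class_eqI:
  assumes "(I, f) \<in> partial_homs R F M" "(J, g) \<in> partial_homs R F M"
    and "K \<in> F" "K \<subseteq> I" "K \<subseteq> J" "\<And>s. s \<in> K \<Longrightarrow> f s = g s"
  shows "hom_class R F M I f = hom_class R F M J g"
proof -
  have "((I, f), (J, g)) \<in> partial_homs_rel R F M"
    unfolding partial_homs_rel_iff by (intro conjI ballI bexI[of _ K] assms)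
  then show ?thesis
    unfolding hom_class_def by (rule equiv_class_eq[OF equiv_partial_homs_rel])
qed

lemma carrier_module_of_quotientsE:
  assumes "\<xi> \<in> carrier (module_of_quotients R F M)"
  obtains I f where "(I, f) \<in> partial_homs R F M" "\<xi> = hom_class R F M I f"
  using assms by (auto simp: module_of_quotients_def hom_class_def elim!: quotientE)

lemma hom_class_in_carrier:
  assumes "(I, f) \<in> partial_homs R F M"
  shows "hom_class R F M I f \<in> carrier (module_of_quotients R F M)"
  using assms by (auto simp: module_of_quotients_def hom_class_def intro: quotientI)

text \<open>The counterpart of \<open>UN_rcoset_eq\<close> for the direct limit: a union over the
  representatives of a class collapses when its summand does not depend on the
  representative.\<close>

lemma UN_hom_class_eq:
  assumes If: "(I, f) \<in> partial_homs R F M"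
    and "\<And>J g. ((I, f), (J, g)) \<in> partial_homs_rel R F M \<Longrightarrow> h J g = h I f"
  shows "(\<Union>(J, g)\<in>hom_class R F M I f. h J g) = h I f"
proof -
  have "(I, f) \<in> hom_class R F M I f"
    unfolding hom_class_def by (rule equiv_class_self[OF equiv_partial_homs_rel If])
  moreover have "h J g = h I f" if "(J, g) \<in> hom_class R F M I f" for J g
    using that assms(2) by (simp add: hom_class_def)
  ultimately show ?thesis by blast
qed

lemma add_partial_homs:
  assumes f: "(I, f) \<in> partial_homs R F M" and g: "(J, g) \<in> partial_homs R F M"
  shows "(I \<inter> J, \<lambda>s\<in>I \<inter> J. f s \<oplus>\<^bsub>Q\<^esub> g s) \<in> partial_homs R F M"
  by (rule partial_homs_restrictI)
    (auto simp: inter_closed partial_homsD[OF f] partial_homsD[OF g] Q.M.a_ac Q.rsmult_l_distr)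

lemma add_hom_class:
  assumes f: "(I, f) \<in> partial_homs R F M" and g: "(J, g) \<in> partial_homs R F M"
  shows "hom_class R F M I f \<oplus>\<^bsub>module_of_quotients R F M\<^esub> hom_class R F M J g =
    hom_class R F M (I \<inter> J) (\<lambda>s\<in>I \<inter> J. f s \<oplus>\<^bsub>Q\<^esub> g s)"
proof -
  let ?h = "\<lambda>I f J g. hom_class R F M (I \<inter> J) (\<lambda>s\<in>I \<inter> J. f s \<oplus>\<^bsub>Q\<^esub> g s)"
  \<comment> \<open>If \<open>f\<close>, \<open>f'\<close> agree on \<open>A\<close> and
    \<open>g\<close>, \<open>g'\<close> agree on \<open>B\<close>, the sums agree on
    \<open>A \<inter> B\<close>.\<close>
  have *: "?h I' f' J' g' = ?h I f J g"
    if "((I, f), (I', f')) \<in> partial_homs_rel R F M" "((J, g), (J', g')) \<in> partial_homs_rel R F M"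
    for I f I' f' J g J' g'
  proof -
    obtain A B where "A \<in> F" "A \<subseteq> I" "A \<subseteq> I'" "\<forall>s\<in>A. f s = f' s"
      "B \<in> F" "B \<subseteq> J" "B \<subseteq> J'" "\<forall>s\<in>B. g s = g' s"
      and ph: "(I, f) \<in> partial_homs R F M" "(J, g) \<in> partial_homs R F M"
        "(I', f') \<in> partial_homs R F M" "(J', g') \<in> partial_homs R F M"
      using \<open>((I, f), (I', f')) \<in> _\<close> \<open>((J, g), (J', g')) \<in> _\<close> unfolding partial_homs_rel_iff by blast
    then show ?thesis
      by (intro hom_class_eqI[OF add_partial_homs add_partial_homs inter_closed[of A B]]) auto
  qed
  have refl: "((I, f), (I, f)) \<in> partial_homs_rel R F M" if "(I, f) \<in> partial_homs R F M" for I f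
    using that partial_homsD(1) by (auto simp: partial_homs_rel_iff)
  \<comment> \<open>The double union is collapsed one variable at a time; \<open>refl\<close> keeps
    the other representative fixed in \<open>*\<close>.\<close>
  have inner: "(\<Union>(J', g')\<in>hom_class R F M J g. ?h I' f' J' g') = ?h I' f' J g"
    if "(I', f') \<in> partial_homs R F M" for I' f'
    by (rule UN_hom_class_eq[OF g]) (rule *[OF refl[OF that]])
  have "(\<Union>(I', f')\<in>hom_class R F M I f. \<Union>(J', g')\<in>hom_class R F M J g. ?h I' f' J' g') =
      (\<Union>(J', g')\<in>hom_class R F M J g. ?h I f J' g')"
  proof (rule UN_hom_class_eq[OF f])
    fix I' f' assume rel: "((I, f), (I', f')) \<in> partial_homs_rel R F M"
    then have f': "(I', f') \<in> partial_homs R F M" by (simp add: partial_homs_rel_iff)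
    show "(\<Union>(J', g')\<in>hom_class R F M J g. ?h I' f' J' g') =
        (\<Union>(J', g')\<in>hom_class R F M J g. ?h I f J' g')"
      unfolding inner[OF f] inner[OF f'] by (rule *[OF rel refl[OF g]])
  qed
  also have "\<dots> = ?h I f J g" by (rule inner[OF f])
  finally show ?thesis
    by (simp add: module_of_quotients_def)
qed

lemma rsmult_partial_homs:
  assumes f: "(I, f) \<in> partial_homs R F M" and r: "r \<in> carrier R"
  shows "(ideal_residual R I r, \<lambda>s\<in>ideal_residual R I r. f (r \<otimes>\<^bsub>R\<^esub> s)) \<in> partial_homs R F M"
  by (rule partial_homs_restrictI)
    (auto simp: ideal_residual_def residual_closed[OF _ r, unfolded ideal_residual_def]
      partial_homsD[OF f] r R.r_distr R.m_assoc[symmetric])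

lemma rsmult_hom_class:
  assumes f: "(I, f) \<in> partial_homs R F M" and r: "r \<in> carrier R"
  shows "hom_class R F M I f \<cdot>\<^bsub>module_of_quotients R F M\<^esub> r =
    hom_class R F M (ideal_residual R I r) (\<lambda>s\<in>ideal_residual R I r. f (r \<otimes>\<^bsub>R\<^esub> s))"
proof -
  let ?h = "\<lambda>I f. hom_class R F M (ideal_residual R I r) (\<lambda>s\<in>ideal_residual R I r. f (r \<otimes>\<^bsub>R\<^esub> s))"
  have "?h J g = ?h I f" if rel: "((I, f), (J, g)) \<in> partial_homs_rel R F M" for J g
  proof -
    obtain K where "K \<in> F" "K \<subseteq> I" "K \<subseteq> J" "\<forall>s\<in>K. f s = g s" and g: "(J, g) \<in> partial_homs R F M"
      using rel unfolding partial_homs_rel_iff by blast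
    then show ?thesis
      \<comment> \<open>Agreement of \<open>f\<close> and \<open>g\<close> on \<open>K\<close> gives
        agreement of the shifted maps on the residual of \<open>K\<close> by \<open>r\<close>, where
        \<open>r s\<close> lies in \<open>K\<close>.\<close>
      by (intro hom_class_eqI[OF rsmult_partial_homs[OF g r] rsmult_partial_homs[OF f r]
            residual_closed[of K, OF _ r]])
        (auto simp: ideal_residual_def)
  qed
  then show ?thesis
    using UN_hom_class_eq[OF f, of ?h] by (simp add: module_of_quotients_def)
qed

end

section \<open>Extending the derivation to the module of quotients of one filter\<close>

locale gabriel_module_derivation = gabriel_module R F M
  for R :: "('a, 'r) ring_scheme" (structure) and F
    and M :: "('a, 'b, 'm) rmodule_scheme" (structure) +
  fixes \<delta> d
  assumes derivation: "derivation R \<delta>" and module_derivation: "module_derivation R \<delta> M d"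
begin

lemma
  shows \<delta>_closed: "\<And>r. r \<in> carrier R \<Longrightarrow> \<delta> r \<in> carrier R"
    and \<delta>_add: "\<And>r s. \<lbrakk>r \<in> carrier R; s \<in> carrier R\<rbrakk> \<Longrightarrow> \<delta> (r \<oplus>\<^bsub>R\<^esub> s) = \<delta> r \<oplus>\<^bsub>R\<^esub> \<delta> s"
    and \<delta>_mult: "\<And>r s. \<lbrakk>r \<in> carrier R; s \<in> carrier R\<rbrakk> \<Longrightarrow>
      \<delta> (r \<otimes>\<^bsub>R\<^esub> s) = \<delta> r \<otimes>\<^bsub>R\<^esub> s \<oplus>\<^bsub>R\<^esub> r \<otimes>\<^bsub>R\<^esub> \<delta> s"
  using derivation unfolding derivation_def by auto

lemma
  shows d_closed: "\<And>x. x \<in> carrier M \<Longrightarrow> d x \<in> carrier M"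
    and d_add: "\<And>x y. \<lbrakk>x \<in> carrier M; y \<in> carrier M\<rbrakk> \<Longrightarrow> d (x \<oplus>\<^bsub>M\<^esub> y) = d x \<oplus>\<^bsub>M\<^esub> d y"
    and d_rsmult: "\<And>x r. \<lbrakk>x \<in> carrier M; r \<in> carrier R\<rbrakk> \<Longrightarrow>
      d (x \<cdot>\<^bsub>M\<^esub> r) = d x \<cdot>\<^bsub>M\<^esub> r \<oplus>\<^bsub>M\<^esub> x \<cdot>\<^bsub>M\<^esub> \<delta> r"
  using module_derivation unfolding module_derivation_def by auto

lemma d_zero: "d \<zero>\<^bsub>M\<^esub> = \<zero>\<^bsub>M\<^esub>"
  using d_add[OF M.zero_closed M.zero_closed] d_closed[OF M.zero_closed] by simp

text \<open>If \<open>I\<close> kills \<open>x\<close> and both \<open>r\<close> and \<delta>(r) lie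
  in \<open>I\<close>, then 0 = d(x r) = d(x) r + x \<delta>(r) = d(x) r. So the derivation preimage
  of \<open>I\<close> kills \<open>d x\<close>.\<close>

lemma d_torsion:
  assumes "x \<in> T" shows "d x \<in> T"
proof -
  obtain I where I: "I \<in> F" "\<And>r. r \<in> I \<Longrightarrow> x \<cdot>\<^bsub>M\<^esub> r = \<zero>\<^bsub>M\<^esub>" and x: "x \<in> carrier M"
    using assms unfolding torsion_iff by blast
  have "d x \<cdot>\<^bsub>M\<^esub> r = \<zero>\<^bsub>M\<^esub>" if "r \<in> derivation_preimage \<delta> I" for r
  proof -
    have r: "r \<in> I" "\<delta> r \<in> I" "r \<in> carrier R"
      using that filter_subset[OF I(1)] by (auto simp: derivation_preimage_def)
    then show ?thesis
      using d_rsmult[OF x, of r] I(2) rsmult_closed[OF d_closed[OF x], of r] by (simp add: d_zero)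
  qed
  then show ?thesis
    unfolding torsion_iff using derivation_preimage_in_filter[OF derivation I(1)] d_closed[OF x] by blast
qed

definition quotient_derivation :: "'b set \<Rightarrow> 'b set"
  where "quotient_derivation X = (\<Union>x\<in>X. T +>\<^bsub>M\<^esub> d x)"

lemma quotient_derivation_coset:
  assumes "x \<in> carrier M"
  shows "quotient_derivation (T +>\<^bsub>M\<^esub> x) = T +>\<^bsub>M\<^esub> d x"
  unfolding quotient_derivation_def
  by (rule M.UN_rcoset_eq[OF torsion_abelian_subgroup torsion_abelian_subgroup])
    (auto simp: d_closed d_add d_torsion assms)

lemma
  shows quotient_derivation_closed: "\<And>X. X \<in> carrier Q \<Longrightarrow> quotient_derivation X \<in> carrier Q"
    and quotient_derivation_add: "\<And>X Y. \<lbrakk>X \<in> carrier Q; Y \<in> carrier Q\<rbrakk> \<Longrightarrow>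
      quotient_derivation (X \<oplus>\<^bsub>Q\<^esub> Y) = quotient_derivation X \<oplus>\<^bsub>Q\<^esub> quotient_derivation Y"
    and quotient_derivation_rsmult: "\<And>X r. \<lbrakk>X \<in> carrier Q; r \<in> carrier R\<rbrakk> \<Longrightarrow>
      quotient_derivation (X \<cdot>\<^bsub>Q\<^esub> r) = quotient_derivation X \<cdot>\<^bsub>Q\<^esub> r \<oplus>\<^bsub>Q\<^esub> X \<cdot>\<^bsub>Q\<^esub> \<delta> r"
  by (auto simp: carrier_quotient quotient_derivation_coset add_coset rsmult_coset
      d_closed d_add d_rsmult \<delta>_closed rsmult_closed)

definition hom_derivation :: "'a set \<Rightarrow> ('a \<Rightarrow> 'b set) \<Rightarrow> 'a \<Rightarrow> 'b set"
  where "hom_derivation I f =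
    (\<lambda>s\<in>derivation_preimage \<delta> I. quotient_derivation (f s) \<ominus>\<^bsub>Q\<^esub> f (\<delta> s))"

lemma derivation_preimageD:
  assumes "I \<in> F" "s \<in> derivation_preimage \<delta> I"
  shows "s \<in> I" "\<delta> s \<in> I" "s \<in> carrier R"
  using assms filter_subset by (auto simp: derivation_preimage_def)

lemma hom_derivation_partial_homs:
  assumes f: "(I, f) \<in> partial_homs R F M"
  shows "(derivation_preimage \<delta> I, hom_derivation I f) \<in> partial_homs R F M"
  unfolding hom_derivation_def
proof (rule partial_homs_restrictI)
  note fD = partial_homsD[OF f] and D = derivation_preimageD[OF partial_homsD(1)[OF f]]
  note mult = R.right_ideal_mult[OF right_ideals[OF fD(1)]]
  note qc = quotient_derivation_closed
  show "derivation_preimage \<delta> I \<in> F"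
    by (rule derivation_preimage_in_filter[OF derivation fD(1)])
  show "quotient_derivation (f s) \<ominus>\<^bsub>Q\<^esub> f (\<delta> s) \<in> carrier Q" if "s \<in> derivation_preimage \<delta> I" for s
    using D[OF that] by (simp add: fD qc Q.M.minus_closed)
  show "quotient_derivation (f (s \<oplus>\<^bsub>R\<^esub> t)) \<ominus>\<^bsub>Q\<^esub> f (\<delta> (s \<oplus>\<^bsub>R\<^esub> t)) =
      (quotient_derivation (f s) \<ominus>\<^bsub>Q\<^esub> f (\<delta> s)) \<oplus>\<^bsub>Q\<^esub> (quotient_derivation (f t) \<ominus>\<^bsub>Q\<^esub> f (\<delta> t))"
    if "s \<in> derivation_preimage \<delta> I" "t \<in> derivation_preimage \<delta> I" for s t
    using D[OF that(1)] D[OF that(2)]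
    by (simp add: fD qc \<delta>_add quotient_derivation_add Q.M.diff_add_distrib)
  show "quotient_derivation (f (s \<otimes>\<^bsub>R\<^esub> r)) \<ominus>\<^bsub>Q\<^esub> f (\<delta> (s \<otimes>\<^bsub>R\<^esub> r)) =
      (quotient_derivation (f s) \<ominus>\<^bsub>Q\<^esub> f (\<delta> s)) \<cdot>\<^bsub>Q\<^esub> r"
    if "s \<in> derivation_preimage \<delta> I" "r \<in> carrier R" for s r
    using D[OF that(1)] that(2)
    \<comment> \<open>Both terms split by the Leibniz rule and both contribute f(s) \<delta>(r);
      \<open>diff_add_cancel_right\<close> removes it. Here \<open>mult\<close> ensures that
      \<delta>(s) r and s \<delta>(r) lie in \<open>I\<close>, so that \<open>f\<close> may be split
      over their sum.\<close>
    by (simp add: fD qc \<delta>_mult \<delta>_closed mult quotient_derivation_rsmult Q.rsmult_closed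
        Q.M.diff_add_cancel_right Q.rsmult_diff_left)
qed

definition quotients_derivation ::
    "('a set \<times> ('a \<Rightarrow> 'b set)) set \<Rightarrow> ('a set \<times> ('a \<Rightarrow> 'b set)) set"
  where "quotients_derivation \<xi> =
    (\<Union>(I, f)\<in>\<xi>. hom_class R F M (derivation_preimage \<delta> I) (hom_derivation I f))"

text \<open>If \<open>f\<close> and \<open>g\<close> agree on \<open>K\<close>, then on the
  derivation preimage of \<open>K\<close> they agree at \<open>s\<close> and at \<delta>(s), which
  is all that the formula evaluates.\<close>

lemma quotients_derivation_hom_class:
  assumes f: "(I, f) \<in> partial_homs R F M"
  shows "quotients_derivation (hom_class R F M I f) =
    hom_class R F M (derivation_preimage \<delta> I) (hom_derivation I f)"
  unfolding quotients_derivation_def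
proof (rule UN_hom_class_eq[OF f])
  fix J g assume "((I, f), (J, g)) \<in> partial_homs_rel R F M"
  then obtain K where "K \<in> F" "K \<subseteq> I" "K \<subseteq> J" "\<forall>s\<in>K. f s = g s" and g: "(J, g) \<in> partial_homs R F M"
    unfolding partial_homs_rel_iff by blast
  then show "hom_class R F M (derivation_preimage \<delta> J) (hom_derivation J g) =
      hom_class R F M (derivation_preimage \<delta> I) (hom_derivation I f)"
    by (intro hom_class_eqI[OF hom_derivation_partial_homs[OF g] hom_derivation_partial_homs[OF f]
          derivation_preimage_in_filter[OF derivation, of K]])
      (auto simp: derivation_preimage_def hom_derivation_def)
qed

lemma quotients_derivation_add:
  assumes f: "(I, f) \<in> partial_homs R F M" and g: "(J, g) \<in> partial_homs R F M"
  defines "MQ \<equiv> module_of_quotients R F M"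
  shows "quotients_derivation (hom_class R F M I f \<oplus>\<^bsub>MQ\<^esub> hom_class R F M J g) =
    quotients_derivation (hom_class R F M I f) \<oplus>\<^bsub>MQ\<^esub> quotients_derivation (hom_class R F M J g)"
  unfolding MQ_def add_hom_class[OF f g] quotients_derivation_hom_class[OF f]
    quotients_derivation_hom_class[OF g] quotients_derivation_hom_class[OF add_partial_homs[OF f g]]
    add_hom_class[OF hom_derivation_partial_homs[OF f] hom_derivation_partial_homs[OF g]]
proof (rule hom_class_eqI)
  note fD = partial_homsD[OF f] and gD = partial_homsD[OF g]
  show "derivation_preimage \<delta> I \<inter> derivation_preimage \<delta> J \<in> F"
    using derivation_preimage_in_filter[OF derivation] fD(1) gD(1) by (intro inter_closed) auto
  show "derivation_preimage \<delta> I \<inter> derivation_preimage \<delta> J \<subseteq> derivation_preimage \<delta> (I \<inter> J)"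
    by (auto simp: derivation_preimage_def)
  fix s assume s: "s \<in> derivation_preimage \<delta> I \<inter> derivation_preimage \<delta> J"
  then have "s \<in> I" "\<delta> s \<in> I" "s \<in> J" "\<delta> s \<in> J" by (auto simp: derivation_preimage_def)
  then show "hom_derivation (I \<inter> J) (\<lambda>s\<in>I \<inter> J. f s \<oplus>\<^bsub>Q\<^esub> g s) s =
      (\<lambda>s\<in>derivation_preimage \<delta> I \<inter> derivation_preimage \<delta> J. hom_derivation I f s \<oplus>\<^bsub>Q\<^esub> hom_derivation J g s) s"
    by (simp add: hom_derivation_def derivation_preimage_def fD gD quotient_derivation_closed
        quotient_derivation_add Q.M.diff_add_distrib)
qed (auto intro: hom_derivation_partial_homs add_partial_homs f g)

text \<open>Write D for the derivation induced on \<open>Q\<close>. At \<open>s\<close> the left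
  side is D(f(r s)) - f(r \<delta>(s)), and the right side is D(f(r s)) - f(\<delta>(r s)) +
  f(\<delta>(r) s). They are equal because \<delta>(r s) = \<delta>(r) s + r \<delta>(s).\<close>

lemma quotients_derivation_rsmult:
  assumes f: "(I, f) \<in> partial_homs R F M" and r: "r \<in> carrier R"
  defines "MQ \<equiv> module_of_quotients R F M"
  shows "quotients_derivation (hom_class R F M I f \<cdot>\<^bsub>MQ\<^esub> r) =
    quotients_derivation (hom_class R F M I f) \<cdot>\<^bsub>MQ\<^esub> r \<oplus>\<^bsub>MQ\<^esub> hom_class R F M I f \<cdot>\<^bsub>MQ\<^esub> \<delta> r"
  unfolding MQ_def rsmult_hom_class[OF f r] rsmult_hom_class[OF f \<delta>_closed[OF r]]
    quotients_derivation_hom_class[OF f] quotients_derivation_hom_class[OF rsmult_partial_homs[OF f r]]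
    rsmult_hom_class[OF hom_derivation_partial_homs[OF f] r]
    add_hom_class[OF rsmult_partial_homs[OF hom_derivation_partial_homs[OF f] r]
      rsmult_partial_homs[OF f \<delta>_closed[OF r]]]
proof (rule hom_class_eqI)
  note fD = partial_homsD[OF f]
  \<comment> \<open>The intersection of the domains of the three terms; on it every argument of
    \<open>f\<close> that occurs lies in \<open>I\<close>.\<close>
  let ?K = "derivation_preimage \<delta> (ideal_residual R I r) \<inter>
    (ideal_residual R (derivation_preimage \<delta> I) r \<inter> ideal_residual R I (\<delta> r))"
  show "?K \<in> F"
    by (intro inter_closed derivation_preimage_in_filter[OF derivation] residual_closed fD(1) r \<delta>_closed)
  fix s assume s: "s \<in> ?K"
  then have s': "s \<in> carrier R" "r \<otimes>\<^bsub>R\<^esub> s \<in> I" "r \<otimes>\<^bsub>R\<^esub> \<delta> s \<in> I" "\<delta> (r \<otimes>\<^bsub>R\<^esub> s) \<in> I" "\<delta> r \<otimes>\<^bsub>R\<^esub> s \<in> I"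
    by (auto simp: derivation_preimage_def ideal_residual_def)
  let ?a = "quotient_derivation (f (r \<otimes>\<^bsub>R\<^esub> s))" and ?b = "f (r \<otimes>\<^bsub>R\<^esub> \<delta> s)" and ?c = "f (\<delta> r \<otimes>\<^bsub>R\<^esub> s)"
  have cl: "?a \<in> carrier Q" "?b \<in> carrier Q" "?c \<in> carrier Q"
    using s' fD quotient_derivation_closed by auto
  have "hom_derivation (ideal_residual R I r) (\<lambda>s\<in>ideal_residual R I r. f (r \<otimes>\<^bsub>R\<^esub> s)) s = ?a \<ominus>\<^bsub>Q\<^esub> ?b"
    using s by (auto simp: hom_derivation_def derivation_preimage_def)
  \<comment> \<open>\<open>?c\<close> is added and subtracted so that the subtracted part becomes
    the value of \<open>f\<close> at \<delta>(r s).\<close>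
  also have "\<dots> = (?a \<ominus>\<^bsub>Q\<^esub> (?c \<oplus>\<^bsub>Q\<^esub> ?b)) \<oplus>\<^bsub>Q\<^esub> ?c"
  proof -
    have "?a \<ominus>\<^bsub>Q\<^esub> ?b = (?a \<oplus>\<^bsub>Q\<^esub> ?c) \<ominus>\<^bsub>Q\<^esub> (?b \<oplus>\<^bsub>Q\<^esub> ?c)"
      using Q.M.diff_add_cancel_right cl by simp
    also have "\<dots> = (?a \<ominus>\<^bsub>Q\<^esub> (?c \<oplus>\<^bsub>Q\<^esub> ?b)) \<oplus>\<^bsub>Q\<^esub> ?c"
      using cl by (simp add: Q.M.minus_eq Q.M.a_ac)
    finally show ?thesis .
  qed
  also have "?c \<oplus>\<^bsub>Q\<^esub> ?b = f (\<delta> (r \<otimes>\<^bsub>R\<^esub> s))"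
    using s' by (simp add: \<delta>_mult r fD)
  also have "(?a \<ominus>\<^bsub>Q\<^esub> f (\<delta> (r \<otimes>\<^bsub>R\<^esub> s))) \<oplus>\<^bsub>Q\<^esub> ?c =
      (\<lambda>s\<in>ideal_residual R (derivation_preimage \<delta> I) r \<inter> ideal_residual R I (\<delta> r).
        (\<lambda>s\<in>ideal_residual R (derivation_preimage \<delta> I) r. hom_derivation I f (r \<otimes>\<^bsub>R\<^esub> s)) s \<oplus>\<^bsub>Q\<^esub>
        (\<lambda>s\<in>ideal_residual R I (\<delta> r). f (\<delta> r \<otimes>\<^bsub>R\<^esub> s)) s) s"
    using s by (auto simp: hom_derivation_def ideal_residual_def)
  finally show "hom_derivation (ideal_residual R I r) (\<lambda>s\<in>ideal_residual R I r. f (r \<otimes>\<^bsub>R\<^esub> s)) s = \<dots>" .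
qed (rule hom_derivation_partial_homs add_partial_homs rsmult_partial_homs f r \<delta>_closed
    Int_lower1 Int_lower2)+

lemma coset_partial_homs:
  assumes "x \<in> carrier M"
  shows "(carrier R, \<lambda>r\<in>carrier R. (T +>\<^bsub>M\<^esub> x) \<cdot>\<^bsub>Q\<^esub> r) \<in> partial_homs R F M"
  by (rule partial_homs_restrictI)
    (auto simp: carrier_in_filter coset_in_quotient assms Q.rsmult_closed Q.rsmult_r_distr Q.rsmult_assoc)

text \<open>For \<open>f\<close> left multiplication by the coset X of \<open>x\<close>, the Leibniz
  rule on \<open>Q\<close> turns D(X s) - X \<delta>(s) into D(X) s, and D(X) is the coset of
  \<open>d x\<close>. The comparison takes place on all of \<open>R\<close>, since \<delta> maps
  \<open>R\<close> into itself.\<close>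

lemma quotients_derivation_quotient_map:
  assumes x: "x \<in> carrier M"
  shows "quotients_derivation (quotient_map R F M x) = quotient_map R F M (d x)"
  unfolding quotient_map_def quotients_derivation_hom_class[OF coset_partial_homs[OF x]]
proof (rule hom_class_eqI[OF hom_derivation_partial_homs[OF coset_partial_homs[OF x]]
      coset_partial_homs[OF d_closed[OF x]]
      derivation_preimage_in_filter[OF derivation carrier_in_filter]])
  fix s assume s: "s \<in> derivation_preimage \<delta> (carrier R)"
  then have "s \<in> carrier R" by (simp add: derivation_preimage_def)
  then show "hom_derivation (carrier R) (\<lambda>r\<in>carrier R. (T +>\<^bsub>M\<^esub> x) \<cdot>\<^bsub>Q\<^esub> r) s =
      (\<lambda>r\<in>carrier R. (T +>\<^bsub>M\<^esub> d x) \<cdot>\<^bsub>Q\<^esub> r) s"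
    using s x
    by (simp add: hom_derivation_def \<delta>_closed quotient_derivation_rsmult coset_in_quotient
        quotient_derivation_coset d_closed Q.rsmult_closed Q.M.minus_eq Q.M.a_assoc Q.M.r_neg)
qed (auto simp: derivation_preimage_def)

lemma extends_quotients_derivation:
  "extends_derivation R F M \<delta> d quotients_derivation"
  unfolding extends_derivation_def module_derivation_def
  by (auto elim!: carrier_module_of_quotientsE simp: quotients_derivation_quotient_map
      quotients_derivation_add quotients_derivation_rsmult quotients_derivation_hom_class
      intro!: hom_class_in_carrier hom_derivation_partial_homs)

end

section \<open>Agreement of the extensions for two comparable filters\<close>

locale gabriel_filter_pair =
  A: gabriel_module_derivation R F M \<delta> d + B: gabriel_module_derivation R F' M \<delta> d
  for R :: "('a, 'r) ring_scheme" (structure) and F F'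
    and M :: "('a, 'b, 'm) rmodule_scheme" (structure) and \<delta> d +
  assumes filter_le: "F \<subseteq> F'"
begin

abbreviation "proj \<equiv> torsion_quotient_proj R F' M"

lemma torsion_mono: "x \<in> A.T \<Longrightarrow> x \<in> B.T"
  unfolding torsion_def using subsetD[OF filter_le] by simp

lemma proj_coset:
  assumes "x \<in> carrier M"
  shows "proj (A.T +>\<^bsub>M\<^esub> x) = B.T +>\<^bsub>M\<^esub> x"
  unfolding torsion_quotient_proj_def
  by (rule A.M.UN_rcoset_eq[OF A.torsion_abelian_subgroup B.torsion_abelian_subgroup,
        where h = "\<lambda>x. x"])
    (simp_all add: torsion_mono assms)

text \<open>On a coset of \<open>x\<close> each of these is \<open>proj_coset\<close> on both sides.
  The last one carries the naturality: both induced derivations come from the same \<open>d\<close>,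
  so either composite sends the coset of \<open>x\<close> to the coset of \<open>d x\<close> modulo
  the larger torsion submodule.\<close>

lemma
  shows proj_closed: "\<And>X. X \<in> carrier A.Q \<Longrightarrow> proj X \<in> carrier B.Q"
    and proj_add: "\<And>X Y. \<lbrakk>X \<in> carrier A.Q; Y \<in> carrier A.Q\<rbrakk> \<Longrightarrow>
      proj (X \<oplus>\<^bsub>A.Q\<^esub> Y) = proj X \<oplus>\<^bsub>B.Q\<^esub> proj Y"
    and proj_rsmult: "\<And>X r. \<lbrakk>X \<in> carrier A.Q; r \<in> carrier R\<rbrakk> \<Longrightarrow>
      proj (X \<cdot>\<^bsub>A.Q\<^esub> r) = proj X \<cdot>\<^bsub>B.Q\<^esub> r"
    and proj_derivation: "\<And>X. X \<in> carrier A.Q \<Longrightarrow>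
      proj (A.quotient_derivation X) = B.quotient_derivation (proj X)"
  by (auto simp: A.carrier_quotient B.coset_in_quotient proj_coset A.add_coset B.add_coset
      A.rsmult_coset B.rsmult_coset A.rsmult_closed A.quotient_derivation_coset
      B.quotient_derivation_coset A.d_closed)

text \<open>Negation is multiplication by \<open>\<ominus> \<one>\<close>, so additivity and
  linearity of \<open>proj\<close> suffice.\<close>

lemma proj_diff:
  assumes "X \<in> carrier A.Q" "Y \<in> carrier A.Q"
  shows "proj (X \<ominus>\<^bsub>A.Q\<^esub> Y) = proj X \<ominus>\<^bsub>B.Q\<^esub> proj Y"
  using assms
  by (simp add: A.Q.M.minus_eq B.Q.M.minus_eq proj_add proj_rsmult proj_closed
      A.Q.rsmult_closed A.Q.rsmult_minus_one[symmetric] B.Q.rsmult_minus_one[symmetric])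

lemma proj_partial_homs:
  assumes f: "(I, f) \<in> partial_homs R F M"
  shows "(I, \<lambda>s\<in>I. proj (f s)) \<in> partial_homs R F' M"
  by (rule B.partial_homs_restrictI)
    (use filter_le A.partial_homsD[OF f] in \<open>auto simp: proj_closed proj_add proj_rsmult\<close>)

text \<open>A member \<open>K\<close> of \<open>F\<close> on which two representatives agree is also
  a member of \<open>F'\<close>, so their projections are equivalent for the larger filter.\<close>

lemma quotient_change_hom_class:
  assumes f: "(I, f) \<in> partial_homs R F M"
  shows "quotient_change R F' M (hom_class R F M I f) = hom_class R F' M I (\<lambda>s\<in>I. proj (f s))"
  unfolding quotient_change_def
proof (rule A.UN_hom_class_eq[OF f])
  fix J g assume "((I, f), (J, g)) \<in> partial_homs_rel R F M"
  then obtain K where "K \<in> F" "K \<subseteq> I" "K \<subseteq> J" "\<forall>s\<in>K. f s = g s" and g: "(J, g) \<in> partial_homs R F M"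
    unfolding A.partial_homs_rel_iff by blast
  then show "hom_class R F' M J (\<lambda>s\<in>J. proj (g s)) = hom_class R F' M I (\<lambda>s\<in>I. proj (f s))"
    using filter_le
    by (intro B.hom_class_eqI[OF proj_partial_homs[OF g] proj_partial_homs[OF f], of K]) auto
qed

text \<open>Both sides are represented on the same domain \<open>?J\<close>, and there they agree
  pointwise: \<open>proj\<close> respects differences and intertwines the two induced derivations,
  so it can be moved through the formula. Hence \<open>?J\<close> itself serves as the common
  smaller member.\<close>

lemma quotients_derivation_agree:
  assumes f: "(I, f) \<in> partial_homs R F M"
  shows "B.quotients_derivation (quotient_change R F' M (hom_class R F M I f)) =
    quotient_change R F' M (A.quotients_derivation (hom_class R F M I f))"
proof -
  let ?J = "derivation_preimage \<delta> I"
  note fD = A.partial_homsD[OF f]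
  note fA = A.hom_derivation_partial_homs[OF f] and fB = proj_partial_homs[OF f]
  have "hom_class R F' M ?J (B.hom_derivation I (\<lambda>s\<in>I. proj (f s))) =
      hom_class R F' M ?J (\<lambda>s\<in>?J. proj (A.hom_derivation I f s))"
    by (rule B.hom_class_eqI[OF B.hom_derivation_partial_homs[OF fB] proj_partial_homs[OF fA],
          of ?J])
      (use A.partial_homsD(1)[OF fA] filter_le in \<open>auto simp: derivation_preimage_def
        A.hom_derivation_def B.hom_derivation_def fD proj_diff proj_derivation
        A.quotient_derivation_closed\<close>)
  then show ?thesis
    by (simp add: quotient_change_hom_class[OF f] quotient_change_hom_class[OF fA]
        A.quotients_derivation_hom_class[OF f] B.quotients_derivation_hom_class[OF fB])
qed

end

theorem proposition2:
  fixes R :: "('a, 'r) ring_scheme"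
    and M :: "('a, 'b, 'm) rmodule_scheme"
    and F\<^sub>1 F\<^sub>2 :: "'a set set"
  assumes "ring R"
    and "gabriel_filter R F\<^sub>1" and "gabriel_filter R F\<^sub>2" and "F\<^sub>1 \<subseteq> F\<^sub>2"
    and "differential_filter R F\<^sub>1"
    and "right_module R M"
    and "torsion_free R F\<^sub>2 (module_of_quotients R F\<^sub>1 M) \<or> differential_filter R F\<^sub>2"
  shows "\<forall>\<delta> d. derivation R \<delta> \<and> module_derivation R \<delta> M d \<longrightarrow>
    (\<exists>d\<^sub>1 d\<^sub>2. extends_derivation R F\<^sub>1 M \<delta> d d\<^sub>1 \<and> extends_derivation R F\<^sub>2 M \<delta> d d\<^sub>2 \<and>
      (\<forall>\<xi>\<in>carrier (module_of_quotients R F\<^sub>1 M).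
        d\<^sub>2 (quotient_change R F\<^sub>2 M \<xi>) = quotient_change R F\<^sub>2 M (d\<^sub>1 \<xi>)))"
proof (intro allI impI, elim conjE)
  fix \<delta> d assume "derivation R \<delta>" "module_derivation R \<delta> M d"
  then interpret gabriel_filter_pair R F\<^sub>1 F\<^sub>2 M \<delta> d
    by (intro gabriel_filter_pair.intro gabriel_module_derivation.intro gabriel_module.intro
        gabriel_module_derivation_axioms.intro gabriel_filter_pair_axioms.intro assms)
  show "\<exists>d\<^sub>1 d\<^sub>2. extends_derivation R F\<^sub>1 M \<delta> d d\<^sub>1 \<and> extends_derivation R F\<^sub>2 M \<delta> d d\<^sub>2 \<and>
      (\<forall>\<xi>\<in>carrier (module_of_quotients R F\<^sub>1 M).
        d\<^sub>2 (quotient_change R F\<^sub>2 M \<xi>) = quotient_change R F\<^sub>2 M (d\<^sub>1 \<xi>))"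
    \<comment> \<open>Every \<xi> in the carrier is the class of some pair, so agreement on classes
      of pairs covers the whole module of quotients.\<close>
    using A.extends_quotients_derivation B.extends_quotients_derivation quotients_derivation_agree
    by (blast elim: A.carrier_module_of_quotientsE)
qed

end
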